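(* The following hold. (1) For $n\equiv 0 \bmod 3$ with $n\geq 858$, every extremal configuration for $c_2(n, K_4)$ is isomorphic to a subgraph of $F_1(\mathcal{E}, n)$ for some admissible $\mathcal{E}$. (2) For $n \equiv 1 \bmod 3$ with $n \geq 715$, every extremal configuration for $c_2(n, K_4)$ is isomorphic to a subgraph of $F_1(\mathcal{E}, n)$ for some admissible $\mathcal{E}$. (3) For $n \equiv 2 \bmod 3$ with $n \geq 1001$, every extremal configuration for $c_2(n, K_4)$ is isomorphic to a subgraph of $F_1(\mathcal{E}, n)$ or to a subgraph of $F_1'(\mathcal{E}, n)$ for some admissible $\mathcal{E}$ (admissible in the sense corresponding to $F_1$ or $F_1'$ respectively).
   Context: A $3$-graph $G=(V,E)$ consists of a finite vertex set $V$ and a set $E$ of $3$-element subsets of $V$ (its edges). A subgraph of $G$ is a $3$-graph $H$ with $V(H)\subseteq V(G)$, $E(H)\subseteq E(G)$; a copy of $F$ in $G$ is a subgraph isomorphic to $F$. The codegree $d(x,y)$ of a pair of distinct vertices is the number of edges containing both, and $\delta_2(G)$ is the minimum codegree over all pairs of distinct vertices. $K_4$ is the complete $3$-graph on $4$ vertices. $G$ has a $K_4$-covering if every vertex of $G$ lies in a copy of $K_4$. For $n\ge 4$, $c_2(n,K_4)=\max\{\delta_2(G): |V(G)|=n,\ G \text{ has no } K_4\text{-covering}\}$. An extremal configuration for $c_2(n,K_4)$ is an $n$-vertex $3$-graph $G$ without a $K_4$-covering with $\delta_2(G)=c_2(n,K_4)$. Base construction. Given a vertex $x\in[n]=\{1,\dots,n\}$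 and a partition $[n]\setminus\{x\}=V_1\sqcup V_2\sqcup V_3$, consider the $3$-graph on $[n]$ whose edges are all triples $xuv$ with $u,v$ in different parts, and all triples not containing $x$ that meet at most two of the parts $V_1,V_2,V_3$. A triple is called tripartite if it contains exactly one vertex from each of $V_1,V_2,V_3$. Given a collection $\mathcal{E}$ of pairs of vertices, each pair having its two vertices in different parts, the modification of the base construction by $\mathcal{E}$ is obtained by, for every $uv\in\mathcal{E}$, deleting the triple $xuv$ and adding all tripartite triples $uvw$ (i.e. $w$ ranges over the part containing neither $u$ nor $v$). $F_1(\mathcal{E},n)$ is the modification by $\mathcal{E}$ of the base construction with the following part sizes, and admissibility of $\mathcal{E}$ (a collection of pairs of vertices from different parts) is defined as follows. - $n=3m$: $|V_1|=m-1$, $|V_2|=|V_3|=m$; $\mathcal{E}$ is admissible if every vertex of $V_1$ is in at most two pairs of $\mathcal{E}$ and every vertex of $V_2\sqcup V_3$ is in at most one pair of $\mathcal{E}$. - $n=3m+1$: $|V_1|=|V_2|=|V_3|=m$; $\mathcal{E}$ is admissible if every vertex of $V_1\sqcup V_2\sqcup V_3$ is in at most one pair of $\mathcal{E}$. - $n=3m+2$: $|V_1|=|V_2|=m$, $|V_3|=m+1$; $\mathcal{E}$ is admissible if every vertex of $V_1\sqcup V_2$ is in at most two pairs of $\mathcal{E}$ and every vertex of $V_3$ is in at most one pair of $\mathcal{E}$. For $n=3m+2$, $F_1'(\mathcal{E},n)$ is the modification by $\mathcal{E}$ of the base construction with part sizes $|V_1|=m-1$, $|V_2|=|V_3|=m+1$;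 in this setting $\mathcal{E}$ is admissible if every vertex of $V_1$ is in at most three pairs of $\mathcal{E}$ and every vertex of $V_2\sqcup V_3$ is in at most one pair of $\mathcal{E}$. *)

theory Defs
  imports "HOL-Library.Ramsey"
begin

datatype 'a hypergraph3 = Hypergraph3 (verts: "'a set") (edges: "'a set set")

definition three_graph :: "'a hypergraph3 \<Rightarrow> bool" where
  "three_graph G \<longleftrightarrow> finite (verts G) \<and> edges G \<subseteq> [verts G]\<^bsup>3\<^esup>"

definition subgraph :: "'a hypergraph3 \<Rightarrow> 'a hypergraph3 \<Rightarrow> bool" where
  "subgraph H G \<longleftrightarrow> three_graph H \<and> verts H \<subseteq> verts G \<and> edges H \<subseteq> edges G"

definition isomorphic :: "'a hypergraph3 \<Rightarrow> 'b hypergraph3 \<Rightarrow> bool" where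
  "isomorphic G H \<longleftrightarrow>
     (\<exists>f. bij_betw f (verts G) (verts H) \<and> edges H = (\<lambda>e. f ` e) ` edges G)"

definition copy_in :: "'a hypergraph3 \<Rightarrow> 'b hypergraph3 \<Rightarrow> 'a hypergraph3 \<Rightarrow> bool" where
  "copy_in H F G \<longleftrightarrow> subgraph H G \<and> isomorphic H F"

definition isomorphic_to_subgraph :: "'a hypergraph3 \<Rightarrow> 'b hypergraph3 \<Rightarrow> bool" where
  "isomorphic_to_subgraph G F \<longleftrightarrow> (\<exists>H. subgraph H F \<and> isomorphic G H)"

definition K4 :: "nat hypergraph3" where
  "K4 = Hypergraph3 {1..4} ([{1..4}]\<^bsup>3\<^esup>)"

definition K4_covering :: "'a hypergraph3 \<Rightarrow> bool" where
  "K4_covering G \<longleftrightarrow> (\<forall>v\<in>verts G. \<exists>H. copy_in H K4 G \<and> v \<in> verts H)"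

definition codegree :: "'a hypergraph3 \<Rightarrow> 'a \<Rightarrow> 'a \<Rightarrow> nat" where
  "codegree G x y = card {e \<in> edges G. x \<in> e \<and> y \<in> e}"

text \<open>Only meaningful for graphs with at least two vertices (otherwise the set below is empty).\<close>

definition min_codegree :: "'a hypergraph3 \<Rightarrow> nat" where
  "min_codegree G = Min {codegree G x y | x y. x \<in> verts G \<and> y \<in> verts G \<and> x \<noteq> y}"

text \<open>The vertices range over \<^typ>\<open>nat\<close>, which up to isomorphism covers all finite vertex
  sets. The number is only meaningful for \<open>n \<ge> 4\<close>.\<close>

definition c2_K4 :: "nat \<Rightarrow> nat" where
  "c2_K4 n = Max {min_codegree G | G :: nat hypergraph3.
                    three_graph G \<and> card (verts G) = n \<and> \<not> K4_covering G}"

definition extremal_K4 :: "nat \<Rightarrow> 'a hypergraph3 \<Rightarrow> bool" where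
  "extremal_K4 n G \<longleftrightarrow> three_graph G \<and> card (verts G) = n \<and> \<not> K4_covering G \<and>
                      min_codegree G = c2_K4 n"

definition vertex_partition :: "nat \<Rightarrow> nat \<Rightarrow> nat set \<Rightarrow> nat set \<Rightarrow> nat set \<Rightarrow> bool" where
  "vertex_partition n x V1 V2 V3 \<longleftrightarrow>
     x \<in> {1..n} \<and> V1 \<union> V2 \<union> V3 = {1..n} - {x} \<and>
     V1 \<inter> V2 = {} \<and> V1 \<inter> V3 = {} \<and> V2 \<inter> V3 = {}"

definition cross_pairs :: "'a set \<Rightarrow> 'a set \<Rightarrow> 'a set \<Rightarrow> 'a set set" where
  "cross_pairs V1 V2 V3 =
     {{u, v} | u v. (u \<in> V1 \<and> v \<in> V2) \<or> (u \<in> V1 \<and> v \<in> V3) \<or> (u \<in> V2 \<and> v \<in> V3)}"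

definition tripartite :: "'a set \<Rightarrow> 'a set \<Rightarrow> 'a set \<Rightarrow> 'a set set" where
  "tripartite V1 V2 V3 = {{a, b, c} | a b c. a \<in> V1 \<and> b \<in> V2 \<and> c \<in> V3}"

definition base_construction ::
  "nat \<Rightarrow> nat \<Rightarrow> nat set \<Rightarrow> nat set \<Rightarrow> nat set \<Rightarrow> nat hypergraph3" where
  "base_construction n x V1 V2 V3 = Hypergraph3 {1..n}
     ({{x, u, v} | u v. {u, v} \<in> cross_pairs V1 V2 V3} \<union>
      {e \<in> [{1..n}]\<^bsup>3\<^esup>. x \<notin> e \<and> (e \<inter> V1 = {} \<or> e \<inter> V2 = {} \<or> e \<inter> V3 = {})})"

text \<open>A pair \<open>uv\<close> is the set \<open>{u, v}\<close>. When its two vertices lie in different parts, the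
  tripartite triples containing it are exactly the \<open>uvw\<close> with \<open>w\<close> in the third part.\<close>

definition modification ::
  "nat \<Rightarrow> nat \<Rightarrow> nat set \<Rightarrow> nat set \<Rightarrow> nat set \<Rightarrow> nat set set \<Rightarrow> nat hypergraph3" where
  "modification n x V1 V2 V3 \<E> = Hypergraph3 {1..n}
     ((edges (base_construction n x V1 V2 V3) - {{x, u, v} | u v. {u, v} \<in> \<E>}) \<union>
      {{u, v, w} | u v w. {u, v} \<in> \<E> \<and> {u, v, w} \<in> tripartite V1 V2 V3})"

definition pairs_at_most :: "'a set set \<Rightarrow> nat \<Rightarrow> 'a set \<Rightarrow> bool" where
  "pairs_at_most \<E> k A \<longleftrightarrow> (\<forall>v\<in>A. card {p \<in> \<E>. v \<in> p} \<le> k)"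

definition F1_parts :: "nat \<Rightarrow> nat \<Rightarrow> nat set \<Rightarrow> nat set \<Rightarrow> nat set \<Rightarrow> bool" where
  "F1_parts n x V1 V2 V3 \<longleftrightarrow> vertex_partition n x V1 V2 V3 \<and>
     (\<exists>m. (n = 3 * m \<and> card V1 = m - 1 \<and> card V2 = m \<and> card V3 = m) \<or>
          (n = 3 * m + 1 \<and> card V1 = m \<and> card V2 = m \<and> card V3 = m) \<or>
          (n = 3 * m + 2 \<and> card V1 = m \<and> card V2 = m \<and> card V3 = m + 1))"

definition F1_admissible ::
  "nat \<Rightarrow> nat set \<Rightarrow> nat set \<Rightarrow> nat set \<Rightarrow> nat set set \<Rightarrow> bool" where
  "F1_admissible n V1 V2 V3 \<E> \<longleftrightarrow> \<E> \<subseteq> cross_pairs V1 V2 V3 \<and>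
     (n mod 3 = 0 \<longrightarrow> pairs_at_most \<E> 2 V1 \<and> pairs_at_most \<E> 1 (V2 \<union> V3)) \<and>
     (n mod 3 = 1 \<longrightarrow> pairs_at_most \<E> 1 (V1 \<union> V2 \<union> V3)) \<and>
     (n mod 3 = 2 \<longrightarrow> pairs_at_most \<E> 2 (V1 \<union> V2) \<and> pairs_at_most \<E> 1 V3)"

definition F1'_parts :: "nat \<Rightarrow> nat \<Rightarrow> nat set \<Rightarrow> nat set \<Rightarrow> nat set \<Rightarrow> bool" where
  "F1'_parts n x V1 V2 V3 \<longleftrightarrow> vertex_partition n x V1 V2 V3 \<and>
     (\<exists>m. n = 3 * m + 2 \<and> card V1 = m - 1 \<and> card V2 = m + 1 \<and> card V3 = m + 1)"

definition F1'_admissible ::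
  "nat set \<Rightarrow> nat set \<Rightarrow> nat set \<Rightarrow> nat set set \<Rightarrow> bool" where
  "F1'_admissible V1 V2 V3 \<E> \<longleftrightarrow> \<E> \<subseteq> cross_pairs V1 V2 V3 \<and>
     pairs_at_most \<E> 3 V1 \<and> pairs_at_most \<E> 1 (V2 \<union> V3)"

text \<open>\<open>is_F1 n F\<close> means that \<open>F\<close> is \<open>F\<^sub>1(\<E>, n)\<close> for some admissible \<open>\<E>\<close>. The vertex \<open>x\<close> and
  the labelling of the parts, which are left implicit in the notation \<open>F\<^sub>1(\<E>, n)\<close>, are
  arbitrary; they affect the graph only up to isomorphism. Likewise for \<open>is_F1'\<close>.\<close>

definition is_F1 :: "nat \<Rightarrow> nat hypergraph3 \<Rightarrow> bool" where
  "is_F1 n F \<longleftrightarrow>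
     (\<exists>x V1 V2 V3 \<E>. F1_parts n x V1 V2 V3 \<and> F1_admissible n V1 V2 V3 \<E> \<and>
                      F = modification n x V1 V2 V3 \<E>)"

definition is_F1' :: "nat \<Rightarrow> nat hypergraph3 \<Rightarrow> bool" where
  "is_F1' n F \<longleftrightarrow>
     (\<exists>x V1 V2 V3 \<E>. F1'_parts n x V1 V2 V3 \<and> F1'_admissible V1 V2 V3 \<E> \<and>
                      F = modification n x V1 V2 V3 \<E>)"

end

theory Submission
  imports Defs
begin

text \<open>
  Let \<open>x\<close> be a vertex of \<open>G\<close> that lies in no copy of \<open>K\<^sub>4\<close>, and let \<open>L\<close> be its link graph on
  the remaining \<open>N = n - 1\<close> vertices. Lower bounds on codegrees become bounds on \<open>L\<close>. If every
  codegree is at least \<open>d\<close>, then \<open>L\<close> has minimum degree at least \<open>d\<close>. Moreover, if \<open>uv\<close> is an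
  edge of \<open>L\<close>, then no common \<open>L\<close>-neighbour \<open>w\<close> of \<open>u\<close> and \<open>v\<close> forms an edge \<open>uvw\<close> of \<open>G\<close>, so
  the codegree of \<open>u, v\<close> forces \<open>uv\<close> to lie in at most \<open>N - 1 - d\<close> triangles of \<open>L\<close>
  (\<open>link_few_triangles_graph\<close>). The base construction shows that an extremal \<open>G\<close> has
  \<open>d\<close> at least about \<open>2n/3\<close> (\<open>c2_K4_ge\<close>); more precisely \<open>3 d \<ge> 2 N - 5\<close>.

  The core of the proof is that such a graph \<open>L\<close> is tripartite
  (\<open>ordered_tripartition_exists\<close>). On average a vertex is adjacent to about \<open>4 \<cdot> 2/3\<close> vertices of
  a complete graph on four vertices, which creates more triangles on its six edges than allowed,
  so \<open>L\<close> contains no such graph. In a triangle \<open>abc\<close>, the same count leaves no slack: all but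
  boundedly many vertices are adjacent to exactly two of \<open>a, b, c\<close>. This gives three independent
  sets \<open>A, B, C\<close> of size about \<open>N/3\<close> each, with almost all edges between them. If a vertex \<open>v\<close> of
  degree \<open>D\<close> has a neighbour in \<open>A\<close>, then almost all its neighbours outside \<open>A\<close> form triangles with
  that edge, so all but about \<open>N/3\<close> of its neighbours lie in \<open>A\<close>. This cannot happen
  for \<open>A\<close>, \<open>B\<close> and \<open>C\<close> at once, as \<open>3 (D - N/3) > D\<close> for \<open>D\<close> about \<open>2N/3\<close> or more. So every vertex
  misses one of \<open>A, B, C\<close> completely, and two vertices that miss the same set have too many common
  neighbours to be adjacent.

  Let \<open>V\<^sub>1, V\<^sub>2, V\<^sub>3\<close> be the three parts and let \<open>\<E>\<close> consist of the pairs across parts that are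
  not edges of \<open>L\<close>. A tripartite edge of \<open>G\<close> contains a pair from \<open>\<E>\<close>, since
  otherwise it forms a \<open>K\<^sub>4\<close> with \<open>x\<close>; so \<open>G\<close> is a subgraph of the modification by \<open>\<E>\<close>
  (\<open>subgraph_modification\<close>). No part has more than \<open>N - 1 - d\<close> vertices
  (\<open>independent_card_le\<close>), which leaves exactly the listed part sizes, and the minimum degree of
  \<open>L\<close> says that a vertex of \<open>V\<^sub>i\<close> lies in at most \<open>N - d - |V\<^sub>i|\<close> pairs of \<open>\<E>\<close>, which is
  admissibility.
\<close>

section \<open>Dense graphs with few triangles on each edge\<close>

text \<open>
  The slack \<open>5\<close> is the largest value of \<open>2 N - 3 d\<close> that occurs for
  \<open>d = \<lfloor>(2n - 5)/3\<rfloor>\<close> and \<open>N = n - 1\<close>; it is attained when \<open>n\<close> is \<open>2\<close> modulo \<open>3\<close>.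
\<close>

locale few_triangles_graph =
  fixes V :: "'a set" and adj :: "'a \<Rightarrow> 'a \<Rightarrow> bool" and d :: nat
  assumes finite_V: "finite V"
    and adj_sym: "adj u v \<Longrightarrow> adj v u"
    and adj_irrefl: "\<not> adj v v"
    and degree: "v \<in> V \<Longrightarrow> d \<le> card {w \<in> V. adj v w}"
    and triangles: "\<lbrakk>u \<in> V; v \<in> V; adj u v\<rbrakk> \<Longrightarrow>
           card {w \<in> V. adj u w \<and> adj v w} + d + 1 \<le> card V"
    and dense: "2 * card V \<le> 3 * d + 5"
    and large: "100 \<le> card V"
begin

lemma card_filter_eq_sum: "int (card {w \<in> V. P w}) = (\<Sum>w\<in>V. of_bool (P w))"
  using finite_V by (simp add: Int_def)

lemma degree_int: "v \<in> V \<Longrightarrow> int d \<le> (\<Sum>w\<in>V. of_bool (adj v w))"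
  using degree[of v] card_filter_eq_sum[of "adj v"] by linarith

lemma triangles_int:
  assumes "u \<in> V" "v \<in> V" "adj u v"
  shows "(\<Sum>w\<in>V. of_bool (adj u w \<and> adj v w)) \<le> int (card V) - int d - 1"
  using triangles[OF assms] card_filter_eq_sum[of "\<lambda>w. adj u w \<and> adj v w"] by linarith

text \<open>
  A vertex adjacent to \<open>k\<close> of the four vertices lies in \<open>k choose 2\<close> of the triangles on the six
  edges, and \<open>k choose 2 \<ge> 2 k - 3\<close>, the chord through \<open>k = 2\<close> and \<open>k = 3\<close>. Summing over all
  vertices gives \<open>2 \<cdot> 4 d - 3 N \<le> 6 (N - 1 - d)\<close>, which is false once \<open>N > 52\<close>.
\<close>

lemma no_K4:
  assumes V: "a \<in> V" "b \<in> V" "c \<in> V" "e \<in> V"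
    and ad: "adj a b" "adj a c" "adj a e" "adj b c" "adj b e" "adj c e"
  shows False
proof -
  let ?one = "\<lambda>u w. of_bool (adj u w) :: int"
  let ?two = "\<lambda>u v w. of_bool (adj u w \<and> adj v w) :: int"
  have "(\<Sum>w\<in>V. 2 * (?one a w + ?one b w + ?one c w + ?one e w))
      \<le> (\<Sum>w\<in>V. 3 + (?two a b w + ?two a c w + ?two a e w + ?two b c w + ?two b e w + ?two c e w))"
    by (rule sum_mono) (auto simp: of_bool_def)
  then have "2 * (sum (?one a) V + sum (?one b) V + sum (?one c) V + sum (?one e) V)
      \<le> 3 * int (card V) + (sum (?two a b) V + sum (?two a c) V + sum (?two a e) V
        + sum (?two b c) V + sum (?two b e) V + sum (?two c e) V)"
    unfolding sum_distrib_left[symmetric] sum.distrib by simp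
  also have "\<dots> \<le> 3 * int (card V) + 6 * (int (card V) - int d - 1)"
    using triangles_int[OF V(1,2) ad(1)] triangles_int[OF V(1,3) ad(2)]
      triangles_int[OF V(1,4) ad(3)] triangles_int[OF V(2,3) ad(4)]
      triangles_int[OF V(2,4) ad(5)] triangles_int[OF V(3,4) ad(6)] by simp
  finally have "2 * (int d + int d + int d + int d)
      \<le> 3 * int (card V) + 6 * (int (card V) - int d - 1)"
    using degree_int[OF V(1)] degree_int[OF V(2)] degree_int[OF V(3)] degree_int[OF V(4)]
    by simp
  then have "14 * int d \<le> 9 * int (card V) - 6"
    by simp
  moreover have "2 * int (card V) \<le> 3 * int d + 5" "100 \<le> int (card V)"
    using dense large by linarith+
  ultimately show False
    by linarith
qed

lemma triangle_exists:
  obtains a b c where "a \<in> V" "b \<in> V" "c \<in> V" "adj a b" "adj a c" "adj b c"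
proof -
  obtain a where a: "a \<in> V"
    using large by fastforce
  have d: "2 * d > card V" "d > 0"
    using dense large by linarith+
  obtain b where b: "b \<in> V" "adj a b"
    using degree[OF a] d by (metis (mono_tags, lifting) card.empty empty_Collect_eq not_le)
  have "card {w \<in> V. adj a w} + card {w \<in> V. adj b w}
      = card ({w \<in> V. adj a w} \<union> {w \<in> V. adj b w})
        + card ({w \<in> V. adj a w} \<inter> {w \<in> V. adj b w})"
    using finite_V by (intro card_Un_Int) auto
  moreover have "card ({w \<in> V. adj a w} \<union> {w \<in> V. adj b w}) \<le> card V"
    using finite_V by (intro card_mono) auto
  ultimately have "card ({w \<in> V. adj a w} \<inter> {w \<in> V. adj b w}) > 0"
    using degree[OF a] degree[OF b(1)] d by linarith
  then have "{w \<in> V. adj a w} \<inter> {w \<in> V. adj b w} \<noteq> {}"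
    by (metis card.empty less_irrefl)
  then obtain c where "c \<in> V" "adj a c" "adj b c"
    by blast
  then show thesis using that a b by blast
qed

lemma independent_degree_le:
  assumes A: "A \<subseteq> V" and v: "v \<in> A" "\<And>w. w \<in> A \<Longrightarrow> \<not> adj v w"
  shows "card {w \<in> V - A. \<not> adj v w} + card A + d \<le> card V"
proof -
  let ?N = "{w \<in> V. adj v w}"
  have fin: "finite A" "finite ?N"
    using finite_V A finite_subset by auto
  have "card V = card ({w \<in> V - A. \<not> adj v w} \<union> (A \<union> ?N))"
    using A by (intro arg_cong[of _ _ card]) auto
  also have "\<dots> = card {w \<in> V - A. \<not> adj v w} + card (A \<union> ?N)"
    using finite_V fin by (intro card_Un_disjoint) auto
  also have "card (A \<union> ?N) = card A + card ?N"
    using fin v by (intro card_Un_disjoint) auto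
  finally show ?thesis
    using degree[of v] A v by auto
qed

text \<open>
  The lower bound \<open>2 d - N - 3\<close> on the size of \<open>A\<close>, assumed in this lemma and the next, is the one
  that holds for the common neighbourhoods of the pairs in a triangle. It leaves a vertex
  \<open>u \<in> A\<close> with at most \<open>N - |A| - d \<le> 2 N + 3 - 3 d \<le> 8\<close> non-neighbours outside \<open>A\<close>.
  Hence all but \<open>8\<close> of the neighbours of \<open>v\<close> outside \<open>A\<close> are common neighbours of \<open>u\<close> and \<open>v\<close>,
  of which there are at most \<open>N - 1 - d\<close>.
\<close>

lemma neighbours_inside_lower:
  assumes A: "A \<subseteq> V" "\<And>u v. u \<in> A \<Longrightarrow> v \<in> A \<Longrightarrow> \<not> adj u v"
    and size: "2 * d \<le> card A + card V + 3"
    and v: "v \<in> V" and u: "u \<in> A" "adj v u"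
  shows "card {w \<in> V. adj v w} + d \<le> card (A \<inter> {w \<in> V. adj v w}) + card V + 7"
proof -
  let ?N = "\<lambda>v. {w \<in> V. adj v w}"
  have uV: "u \<in> V" using u A by auto
  have fin: "finite A" "finite (?N v)"
    using finite_V A(1) finite_subset by auto
  have few: "card {w \<in> V - A. \<not> adj u w} \<le> 8"
    using independent_degree_le[OF A(1) u(1) A(2)[OF u(1)]] size dense by linarith
  have "?N v \<subseteq> (A \<inter> ?N v) \<union> {w \<in> V - A. \<not> adj u w} \<union> {w \<in> V. adj v w \<and> adj u w}"
    by auto
  then have "card (?N v) \<le> card ((A \<inter> ?N v) \<union> {w \<in> V - A. \<not> adj u w} \<union> {w \<in> V. adj v w \<and> adj u w})"
    using finite_V fin by (intro card_mono) auto
  also have "\<dots> \<le> card (A \<inter> ?N v) + card {w \<in> V - A. \<not> adj u w} + card {w \<in> V. adj v w \<and> adj u w}"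
    using card_Un_le[of "(A \<inter> ?N v) \<union> {w \<in> V - A. \<not> adj u w}" "{w \<in> V. adj v w \<and> adj u w}"]
      card_Un_le[of "A \<inter> ?N v" "{w \<in> V - A. \<not> adj u w}"] by linarith
  finally show ?thesis
    using few triangles[OF v uV u(2)] by linarith
qed

text \<open>
  The neighbourhoods of \<open>u\<close> and \<open>v\<close> both lie in the complement of \<open>A\<close>, which has at most about
  \<open>2N/3\<close> vertices, so they almost coincide. If \<open>u\<close> and \<open>v\<close> were adjacent, their edge would
  lie in about \<open>2N/3\<close> triangles.
\<close>

lemma avoiding_common_set_independent:
  assumes A: "A \<subseteq> V"
    and size: "2 * d \<le> card A + card V + 3"
    and u: "u \<in> V" "\<And>w. w \<in> A \<Longrightarrow> \<not> adj u w"
    and v: "v \<in> V" "\<And>w. w \<in> A \<Longrightarrow> \<not> adj v w"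
  shows "\<not> adj u v"
proof
  assume uv: "adj u v"
  let ?N = "\<lambda>v. {w \<in> V. adj v w}"
  have "card (?N u) + card (?N v) = card (?N u \<union> ?N v) + card (?N u \<inter> ?N v)"
    using finite_V by (intro card_Un_Int) auto
  moreover have "card (?N u \<union> ?N v) \<le> card (V - A)"
    using finite_V u v by (intro card_mono) auto
  moreover have "card (V - A) + card A = card V"
    using A finite_V by (metis card_Diff_subset card_mono finite_subset le_add_diff_inverse2)
  moreover have "?N u \<inter> ?N v = {w \<in> V. adj u w \<and> adj v w}"
    by auto
  ultimately show False
    using degree[OF u(1)] degree[OF v(1)] triangles[OF u(1) v(1) uv] size dense large by simp
qed

lemma common_neighbourhood_independent:
  assumes "a \<in> V" "b \<in> V" "adj a b" "u \<in> {w \<in> V. adj a w \<and> adj b w}"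
    "v \<in> {w \<in> V. adj a w \<and> adj b w}"
  shows "\<not> adj u v"
  using assms no_K4[of a b u v] by auto

lemma tripartition_exists:
  obtains V1 V2 V3 where "V = V1 \<union> V2 \<union> V3" "V1 \<inter> V2 = {}" "V1 \<inter> V3 = {}" "V2 \<inter> V3 = {}"
    "\<And>u v. u \<in> V1 \<Longrightarrow> v \<in> V1 \<Longrightarrow> \<not> adj u v"
    "\<And>u v. u \<in> V2 \<Longrightarrow> v \<in> V2 \<Longrightarrow> \<not> adj u v"
    "\<And>u v. u \<in> V3 \<Longrightarrow> v \<in> V3 \<Longrightarrow> \<not> adj u v"
proof -
  obtain a b c where V: "a \<in> V" "b \<in> V" "c \<in> V" and ad: "adj a b" "adj a c" "adj b c"
    by (rule triangle_exists)
  define A where "A = {w \<in> V. adj b w \<and> adj c w}"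
  define B where "B = {w \<in> V. adj a w \<and> adj c w}"
  define C where "C = {w \<in> V. adj a w \<and> adj b w}"
  have K4: "\<not> (adj a w \<and> adj b w \<and> adj c w)" if "w \<in> V" for w
    using no_K4[OF V that] ad by blast
  have sub: "A \<subseteq> V" "B \<subseteq> V" "C \<subseteq> V"
    by (auto simp: A_def B_def C_def)
  have disj: "A \<inter> B = {}" "A \<inter> C = {}" "B \<inter> C = {}"
    using K4 by (auto simp: A_def B_def C_def)
  have upper: "card A + d + 1 \<le> card V" "card B + d + 1 \<le> card V" "card C + d + 1 \<le> card V"
    using triangles V ad by (auto simp: A_def B_def C_def)
  have indep: "\<not> adj u v" if "u \<in> A \<and> v \<in> A \<or> u \<in> B \<and> v \<in> B \<or> u \<in> C \<and> v \<in> C" for u v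
    using that common_neighbourhood_independent V ad unfolding A_def B_def C_def by blast
  \<comment> \<open>Since no vertex is adjacent to all of \<open>a, b, c\<close>, the number \<open>k \<le> 2\<close> of its neighbours among
    them satisfies \<open>k \<le> 1 + (k choose 2)\<close>.\<close>
  have "3 * int d \<le> int (card V) + int (card A) + int (card B) + int (card C)"
  proof -
    let ?one = "\<lambda>u w. of_bool (adj u w) :: int"
    let ?two = "\<lambda>u v w. of_bool (adj u w \<and> adj v w) :: int"
    have "(\<Sum>w\<in>V. ?one a w + ?one b w + ?one c w)
        \<le> (\<Sum>w\<in>V. 1 + ?two b c w + ?two a c w + ?two a b w)"
      using K4 by (intro sum_mono) (auto simp: of_bool_def)
    then have "sum (?one a) V + sum (?one b) V + sum (?one c) V
        \<le> int (card V) + sum (?two b c) V + sum (?two a c) V + sum (?two a b) V"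
      by (simp only: sum.distrib) simp
    then show ?thesis
      using degree_int[OF V(1)] degree_int[OF V(2)] degree_int[OF V(3)]
      unfolding A_def B_def C_def card_filter_eq_sum by linarith
  qed
  then have size: "2 * d \<le> card A + card V + 3"
    "2 * d \<le> card B + card V + 3"
    "2 * d \<le> card C + card V + 3"
    using upper dense by linarith+
  \<comment> \<open>Otherwise the degree \<open>D\<close> of \<open>v\<close> satisfies \<open>D \<ge> 3 (D + d - N - 7)\<close>, that is
    \<open>2 D \<le> 3 (N - d + 7)\<close>: about \<open>4N/3\<close> is at most about \<open>N\<close>.\<close>
  have avoid: "A \<inter> {w \<in> V. adj v w} = {} \<or> B \<inter> {w \<in> V. adj v w} = {} \<or> C \<inter> {w \<in> V. adj v w} = {}"
    if v: "v \<in> V" for v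
  proof (rule ccontr)
    let ?N = "{w \<in> V. adj v w}"
    assume "\<not> ?thesis"
    then obtain a' b' c' where abc: "a' \<in> A" "adj v a'" "b' \<in> B" "adj v b'" "c' \<in> C" "adj v c'"
      by blast
    have "card ?N + d \<le> card (A \<inter> ?N) + card V + 7"
      by (rule neighbours_inside_lower[OF sub(1) _ size(1) v abc(1,2)]) (use indep in simp)
    moreover have "card ?N + d \<le> card (B \<inter> ?N) + card V + 7"
      by (rule neighbours_inside_lower[OF sub(2) _ size(2) v abc(3,4)]) (use indep in simp)
    moreover have "card ?N + d \<le> card (C \<inter> ?N) + card V + 7"
      by (rule neighbours_inside_lower[OF sub(3) _ size(3) v abc(5,6)]) (use indep in simp)
    moreover have "card (A \<inter> ?N) + card (B \<inter> ?N) + card (C \<inter> ?N) \<le> card ?N"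
    proof -
      have fin: "finite A" "finite B" "finite C"
        using sub finite_V finite_subset by blast+
      have "card (A \<inter> ?N) + card (B \<inter> ?N) + card (C \<inter> ?N)
          = card ((A \<inter> ?N) \<union> (B \<inter> ?N) \<union> (C \<inter> ?N))"
        using fin disj by (subst card_Un_disjoint; (subst card_Un_disjoint)?) auto
      also have "\<dots> \<le> card ?N"
        using finite_V by (intro card_mono) auto
      finally show ?thesis .
    qed
    ultimately show False
      using degree[OF v] dense large by linarith
  qed
  define V1 where "V1 = {v \<in> V. \<forall>w\<in>A. \<not> adj v w}"
  define V2 where "V2 = {v \<in> V. \<forall>w\<in>B. \<not> adj v w} - V1"
  define V3 where "V3 = V - V1 - V2"
  show thesis
  proof (rule that[of V1 V2 V3])
    show "V = V1 \<union> V2 \<union> V3" "V1 \<inter> V2 = {}" "V1 \<inter> V3 = {}" "V2 \<inter> V3 = {}"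
      by (auto simp: V1_def V2_def V3_def)
    show "\<not> adj u v" if "u \<in> V1" "v \<in> V1" for u v
      using that avoiding_common_set_independent[OF sub(1) size(1)] by (auto simp: V1_def)
    show "\<not> adj u v" if "u \<in> V2" "v \<in> V2" for u v
      using that avoiding_common_set_independent[OF sub(2) size(2)] by (auto simp: V2_def)
    have "\<forall>w\<in>C. \<not> adj v w" if "v \<in> V3" for v
      using that avoid[of v] sub unfolding V1_def V2_def V3_def by blast
    then show "\<not> adj u v" if "u \<in> V3" "v \<in> V3" for u v
      using that avoiding_common_set_independent[OF sub(3) size(3)] by (auto simp: V3_def)
  qed
qed

text \<open>
  By the degree bound an independent set has at most \<open>N - d\<close> vertices. If it had exactly that many,
  each of its vertices would be adjacent to everything outside, so an edge outside \<open>A\<close>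
  would have all \<open>N - d\<close> vertices of \<open>A\<close> as common neighbours. Such an edge exists,
  as a vertex outside \<open>A\<close> has more neighbours than \<open>A\<close> has vertices.
\<close>

lemma independent_card_le:
  assumes A: "A \<subseteq> V" "\<And>v w. v \<in> A \<Longrightarrow> w \<in> A \<Longrightarrow> \<not> adj v w"
  shows "card A + d + 1 \<le> card V"
proof (rule ccontr)
  assume "\<not> ?thesis"
  then have big: "card V \<le> card A + d"
    by simp
  have fin: "finite A" "finite (V - A)"
    using A(1) finite_V finite_subset by auto
  obtain a where a: "a \<in> V"
    using large by fastforce
  have d: "d + 1 \<le> card V" "0 < d"
  proof -
    obtain u v w where "u \<in> V" "v \<in> V" "adj u v"
      using triangle_exists by blast
    then show "d + 1 \<le> card V"
      using triangles[of u v] by linarith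
    show "0 < d" using dense large by linarith
  qed
  obtain v0 where v0: "v0 \<in> A"
    using big d by fastforce
  have le: "card A + d \<le> card V"
    using independent_degree_le[OF A(1) v0 A(2)[OF v0]] by linarith
  have full: "adj u w" if "u \<in> V" "u \<notin> A" "w \<in> A" for u w
  proof -
    have "card {x \<in> V - A. \<not> adj w x} = 0"
      using independent_degree_le[OF A(1) that(3) A(2)[OF that(3)]] big by linarith
    then have "{x \<in> V - A. \<not> adj w x} = {}"
      using fin by simp
    then have "adj w u" using that by blast
    then show ?thesis by (rule adj_sym)
  qed
  have "card (V - A) + card A = card V"
    using fin A(1) finite_V by (metis card_Diff_subset card_mono le_add_diff_inverse2)
  then have "card (V - A) \<noteq> 0"
    using le d by linarith
  then have "V - A \<noteq> {}"
    by (metis card.empty)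
  then obtain u where u: "u \<in> V" "u \<notin> A"
    by blast
  have "card A < card {w \<in> V. adj u w}"
    using degree[OF u(1)] le dense large by linarith
  then have "\<not> {w \<in> V. adj u w} \<subseteq> A"
    using fin card_mono by (metis linorder_not_less)
  then obtain w where w: "w \<in> V" "adj u w" "w \<notin> A"
    by blast
  have "card A \<le> card {x \<in> V. adj u x \<and> adj w x}"
    using full u w A(1) finite_V by (intro card_mono) auto
  then show False
    using triangles[OF u(1) w(1,2)] big by linarith
qed

lemma ordered_tripartition_exists:
  obtains V1 V2 V3 where "V = V1 \<union> V2 \<union> V3" "V1 \<inter> V2 = {}" "V1 \<inter> V3 = {}" "V2 \<inter> V3 = {}"
    "\<And>A u v. A \<in> {V1, V2, V3} \<Longrightarrow> u \<in> A \<Longrightarrow> v \<in> A \<Longrightarrow> \<not> adj u v"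
    "\<And>A. A \<in> {V1, V2, V3} \<Longrightarrow> card A + d + 1 \<le> card V"
    "card V1 \<le> card V2" "card V2 \<le> card V3"
proof -
  define good where "good A B C \<longleftrightarrow> V = A \<union> B \<union> C \<and> A \<inter> B = {} \<and> A \<inter> C = {} \<and> B \<inter> C = {} \<and>
     (\<forall>S\<in>{A, B, C}. \<forall>u\<in>S. \<forall>v\<in>S. \<not> adj u v)" for A B C
  obtain A B C where ABC: "good A B C"
  proof (rule tripartition_exists)
    fix A B C
    assume "V = A \<union> B \<union> C" "A \<inter> B = {}" "A \<inter> C = {}" "B \<inter> C = {}"
      "\<And>u v. u \<in> A \<Longrightarrow> v \<in> A \<Longrightarrow> \<not> adj u v" "\<And>u v. u \<in> B \<Longrightarrow> v \<in> B \<Longrightarrow> \<not> adj u v"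
      "\<And>u v. u \<in> C \<Longrightarrow> v \<in> C \<Longrightarrow> \<not> adj u v"
    then have "good A B C"
      unfolding good_def by simp
    then show thesis by (rule that)
  qed
  have swap: "good B A C" "good A C B" if "good A B C" for A B C
  proof -
    show "good B A C" using that unfolding good_def by (simp add: Int_commute Un_ac)
    show "good A C B" using that unfolding good_def by (simp add: Int_commute Un_ac)
  qed
  have "\<exists>A B C. good A B C \<and> card A \<le> card B \<and> card B \<le> card C"
  proof -
    have perms: "good A C B" "good B A C" "good B C A" "good C A B" "good C B A"
      using swap ABC by metis+
    consider "card A \<le> card B" "card B \<le> card C" | "card A \<le> card C" "card C \<le> card B"
      | "card B \<le> card A" "card A \<le> card C" | "card B \<le> card C" "card C \<le> card A"
      | "card C \<le> card A" "card A \<le> card B" | "card C \<le> card B" "card B \<le> card A"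
      by linarith
    then show ?thesis
      by cases (use ABC perms in blast)+
  qed
  then obtain V1 V2 V3 where *: "good V1 V2 V3" "card V1 \<le> card V2" "card V2 \<le> card V3"
    by blast
  have part: "V = V1 \<union> V2 \<union> V3" "V1 \<inter> V2 = {}" "V1 \<inter> V3 = {}" "V2 \<inter> V3 = {}"
    using *(1) unfolding good_def by simp_all
  have indep: "\<not> adj u v" if "A \<in> {V1, V2, V3}" "u \<in> A" "v \<in> A" for A u v
    using *(1) that unfolding good_def by auto
  have small: "card A + d + 1 \<le> card V" if A: "A \<in> {V1, V2, V3}" for A
  proof (rule independent_card_le)
    show "A \<subseteq> V" using A part(1) by auto
    show "\<not> adj v w" if "v \<in> A" "w \<in> A" for v w using indep[OF A that] .
  qed
  show thesis
    by (rule that[OF part indep small *(2,3)])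
qed

end

section \<open>Vertices covered by a complete 3-graph on four vertices\<close>

text \<open>
  Distinctness of \<open>x, u, v, w\<close> is implicit: in a 3-graph every edge has three elements.
\<close>

definition K4_at :: "'a hypergraph3 \<Rightarrow> 'a \<Rightarrow> bool" where
  "K4_at G x \<longleftrightarrow> (\<exists>u v w. {x, u, v} \<in> edges G \<and> {x, u, w} \<in> edges G \<and>
                          {x, v, w} \<in> edges G \<and> {u, v, w} \<in> edges G)"

lemma three_graph_edgeD:
  assumes "three_graph G" "{a, b, c} \<in> edges G"
  shows "a \<in> verts G" "b \<in> verts G" "c \<in> verts G" "a \<noteq> b" "a \<noteq> c" "b \<noteq> c"
proof -
  have "{a, b, c} \<subseteq> verts G" "card {a, b, c} = 3"
    using assms unfolding three_graph_def nsets_def by blast+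
  then show "a \<in> verts G" "b \<in> verts G" "c \<in> verts G" "a \<noteq> b" "a \<noteq> c" "b \<noteq> c"
    by (auto simp: card_insert_if split: if_splits)
qed

lemma K4_copy_imp_K4_at:
  assumes copy: "copy_in H K4 G" and x: "x \<in> verts H"
  shows "K4_at G x"
proof -
  have H: "three_graph H" "edges H \<subseteq> edges G"
    using copy by (auto simp: copy_in_def subgraph_def)
  obtain f :: "'a \<Rightarrow> nat" where f: "bij_betw f (verts H) {1..4}" and fE: "[{1..4}]\<^bsup>3\<^esup> = (\<lambda>e. f ` e) ` edges H"
    using copy unfolding copy_in_def isomorphic_def K4_def by auto
  have edge: "e \<in> edges G" if e: "e \<subseteq> verts H" "card e = 3" for e
  proof -
    have inj: "inj_on f e"
      using f e(1) by (meson bij_betw_def inj_on_subset)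
    have "f ` e \<in> [{1..4}]\<^bsup>3\<^esup>"
      using e f card_image[OF inj] unfolding nsets_def bij_betw_def
      by (auto intro: card_ge_0_finite)
    then obtain e' where e': "e' \<in> edges H" "f ` e = f ` e'"
      using fE by auto
    moreover have "e' \<subseteq> verts H"
      using e'(1) H(1) by (auto simp: three_graph_def nsets_def)
    ultimately have "e = e'"
      using e(1) f by (meson bij_betw_def inj_on_image_eq_iff)
    then show ?thesis
      using e'(1) H(2) by blast
  qed
  have "card (verts H) = 4"
    using bij_betw_same_card[OF f] by simp
  then have "card (verts H - {x}) = 3"
    using x by (simp add: card_ge_0_finite)
  then obtain u v w where uvw: "verts H - {x} = {u, v, w}" "u \<noteq> v" "u \<noteq> w" "v \<noteq> w"
    by (auto simp: card_3_iff)
  then have "x \<noteq> u" "x \<noteq> v" "x \<noteq> w" "{u, v, w} \<subseteq> verts H"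
    by auto
  then show ?thesis
    unfolding K4_at_def using uvw(2-4) x by (intro exI conjI; intro edge) auto
qed

lemma K4_at_imp_K4_copy:
  assumes G: "three_graph G" and K: "K4_at G x"
  shows "\<exists>H. copy_in H K4 G \<and> x \<in> verts H"
proof -
  obtain u v w where e: "{x, u, v} \<in> edges G" "{x, u, w} \<in> edges G"
      "{x, v, w} \<in> edges G" "{u, v, w} \<in> edges G"
    using K by (auto simp: K4_at_def)
  let ?S = "{x, u, v, w}"
  have dist: "x \<noteq> u" "x \<noteq> v" "x \<noteq> w" "u \<noteq> v" "u \<noteq> w" "v \<noteq> w" and S: "?S \<subseteq> verts G"
    using three_graph_edgeD[OF G e(1)] three_graph_edgeD[OF G e(2)] three_graph_edgeD[OF G e(3)]
    by auto
  have sub: "[?S]\<^bsup>3\<^esup> \<subseteq> edges G"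
  proof
    fix e' assume "e' \<in> [?S]\<^bsup>3\<^esup>"
    then have e': "e' \<subseteq> ?S" "card e' = 3" by (auto simp: nsets_def)
    then have "card (?S - e') = 1"
      using dist by (subst card_Diff_subset) (auto intro: finite_subset)
    then obtain y where "?S - e' = {y}"
      by (auto simp: card_1_singleton_iff)
    then have "y \<in> ?S" "e' = ?S - {y}"
      using e'(1) by auto
    then show "e' \<in> edges G"
      using e dist by (auto simp: insert_Diff_if)
  qed
  have "card ?S = card {1..4::nat}"
    using dist by simp
  then obtain f where f: "bij_betw f ?S {1..4::nat}"
    using finite_same_card_bij[of ?S "{1..4::nat}"] by auto
  have "[{1..4}]\<^bsup>3\<^esup> = (\<lambda>e. f ` e) ` [?S]\<^bsup>3\<^esup>"
    using bij_betw_nsets[OF f, of 3] by (simp add: bij_betw_def)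
  then have "copy_in (Hypergraph3 ?S ([?S]\<^bsup>3\<^esup>)) K4 G"
    using f S sub unfolding copy_in_def subgraph_def isomorphic_def K4_def three_graph_def by auto
  then show ?thesis
    by (intro exI[of _ "Hypergraph3 ?S ([?S]\<^bsup>3\<^esup>)"]) auto
qed

lemma K4_covering_iff: "three_graph G \<Longrightarrow> K4_covering G \<longleftrightarrow> (\<forall>x\<in>verts G. K4_at G x)"
  using K4_copy_imp_K4_at K4_at_imp_K4_copy unfolding K4_covering_def by metis

section \<open>Codegrees\<close>

text \<open>
  The vertices \<open>y\<close> and \<open>z\<close> themselves are never counted, since \<open>{y, z}\<close> is no edge.
\<close>

lemma codegree_eq_card:
  assumes G: "three_graph G" and y: "y \<noteq> z"
  shows "codegree G y z = card {w \<in> verts G. {y, z, w} \<in> edges G}"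
proof -
  have "bij_betw (\<lambda>w. {y, z, w}) {w \<in> verts G. {y, z, w} \<in> edges G} {e \<in> edges G. y \<in> e \<and> z \<in> e}"
  proof (rule bij_betw_imageI)
    show "inj_on (\<lambda>w. {y, z, w}) {w \<in> verts G. {y, z, w} \<in> edges G}"
    proof (rule inj_onI)
      fix w w'
      assume "w \<in> {w \<in> verts G. {y, z, w} \<in> edges G}" "w' \<in> {w \<in> verts G. {y, z, w} \<in> edges G}"
        and eq: "{y, z, w} = {y, z, w'}"
      then have "w \<noteq> y" "w \<noteq> z"
        using three_graph_edgeD[OF G, of y z w] by auto
      then show "w = w'"
        using eq by blast
    qed
    have "e \<in> (\<lambda>w. {y, z, w}) ` {w \<in> verts G. {y, z, w} \<in> edges G}"
      if e: "e \<in> edges G" "y \<in> e" "z \<in> e" for e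
    proof -
      have "card e = 3" "e \<subseteq> verts G"
        using e(1) G unfolding three_graph_def nsets_def by auto
      then have "card (e - {y, z}) = 1"
        using e y by (subst card_Diff_subset) auto
      then obtain w where "e - {y, z} = {w}"
        by (auto simp: card_1_singleton_iff)
      then have "e = {y, z, w}" using e by auto
      then show ?thesis using e(1) \<open>e \<subseteq> verts G\<close> by auto
    qed
    then show "(\<lambda>w. {y, z, w}) ` {w \<in> verts G. {y, z, w} \<in> edges G} = {e \<in> edges G. y \<in> e \<and> z \<in> e}"
      by auto
  qed
  from bij_betw_same_card[OF this] show ?thesis
    unfolding codegree_def by simp
qed

text \<open>
  The crude bound serves only to show that the set of codegrees, and the set whose maximum is
  \<^const>\<open>c2_K4\<close>, are finite.
\<close>

lemma codegree_le:
  assumes "three_graph G"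
  shows "codegree G y z \<le> 2 ^ card (verts G)"
proof -
  have "{e \<in> edges G. y \<in> e \<and> z \<in> e} \<subseteq> Pow (verts G)"
    using assms unfolding three_graph_def nsets_def by auto
  then have "codegree G y z \<le> card (Pow (verts G))"
    unfolding codegree_def using assms by (intro card_mono) (auto simp: three_graph_def)
  then show ?thesis
    using assms by (simp add: card_Pow three_graph_def)
qed

lemma finite_codegrees:
  assumes "three_graph G"
  shows "finite {codegree G x y | x y. x \<in> verts G \<and> y \<in> verts G \<and> x \<noteq> y}"
  by (rule finite_subset[of _ "{..2 ^ card (verts G)}"]) (use codegree_le[OF assms] in auto)

lemma min_codegree_le:
  assumes "three_graph G" "x \<in> verts G" "y \<in> verts G" "x \<noteq> y"
  shows "min_codegree G \<le> codegree G x y"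
  unfolding min_codegree_def using finite_codegrees[OF assms(1)] assms by (intro Min_le) auto

lemma min_codegree_attained:
  assumes "three_graph G" "2 \<le> card (verts G)"
  shows "\<exists>x y. x \<in> verts G \<and> y \<in> verts G \<and> x \<noteq> y \<and> min_codegree G = codegree G x y"
proof -
  obtain x y where "x \<in> verts G" "y \<in> verts G" "x \<noteq> y"
    using assms card_le_Suc0_iff_eq[of "verts G"] unfolding three_graph_def by fastforce
  then have "{codegree G x y | x y. x \<in> verts G \<and> y \<in> verts G \<and> x \<noteq> y} \<noteq> {}"
    by blast
  from Min_in[OF finite_codegrees[OF assms(1)] this] show ?thesis
    unfolding min_codegree_def by blast
qed

lemma c2_K4_lower:
  fixes G :: "nat hypergraph3"
  assumes "three_graph G" "card (verts G) = n" "\<not> K4_covering G" "2 \<le> n"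
  shows "min_codegree G \<le> c2_K4 n"
  unfolding c2_K4_def
proof (rule Max_ge)
  have "min_codegree H \<le> 2 ^ n" if H: "three_graph H" "card (verts H) = n"
    for H :: "nat hypergraph3"
  proof -
    obtain x y where "min_codegree H = codegree H x y"
      using min_codegree_attained[OF H(1)] H(2) assms(4) by blast
    then show ?thesis
      using codegree_le[OF H(1), of x y] H(2) by simp
  qed
  then show "finite {min_codegree G | G :: nat hypergraph3.
                    three_graph G \<and> card (verts G) = n \<and> \<not> K4_covering G}"
    by (blast intro: finite_subset[OF _ finite_atMost[of "2 ^ n"]])
  show "min_codegree G \<in> {min_codegree G | G :: nat hypergraph3.
                    three_graph G \<and> card (verts G) = n \<and> \<not> K4_covering G}"
    using assms(1-3) by blast
qed

section \<open>The lower bound from the base construction\<close>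

lemma cross_pairs_iff:
  "{u, v} \<in> cross_pairs A B C \<longleftrightarrow>
     u \<in> A \<and> v \<in> B \<or> u \<in> A \<and> v \<in> C \<or> u \<in> B \<and> v \<in> C \<or>
     v \<in> A \<and> u \<in> B \<or> v \<in> A \<and> u \<in> C \<or> v \<in> B \<and> u \<in> C"
  unfolding cross_pairs_def by (auto simp: doubleton_eq_iff)

lemma cross_pairs_permute:
  shows cross_pairs_swap12: "cross_pairs B A C = cross_pairs A B C"
    and cross_pairs_swap23: "cross_pairs A C B = cross_pairs A B C"
proof -
  have eqI: "P = Q"
    if "\<And>u v. {u, v} \<in> P \<longleftrightarrow> {u, v} \<in> Q" "\<And>p. p \<in> P \<union> Q \<Longrightarrow> \<exists>u v. p = {u, v}" for P Q :: "'a set set"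
    using that by blast
  show "cross_pairs B A C = cross_pairs A B C"
    by (rule eqI) (unfold cross_pairs_iff, blast, auto simp: cross_pairs_def)
  show "cross_pairs A C B = cross_pairs A B C"
    by (rule eqI) (unfold cross_pairs_iff, blast, auto simp: cross_pairs_def)
qed

lemma base_construction_permute:
  shows base_construction_swap12: "base_construction n x B A C = base_construction n x A B C"
    and base_construction_swap23: "base_construction n x A C B = base_construction n x A B C"
  unfolding base_construction_def cross_pairs_swap12[of B A C] cross_pairs_swap23[of A C B]
  by (simp_all only: disj_left_commute disj_commute)

lemma vertex_partition_permute:
  "vertex_partition n x A B C \<Longrightarrow> vertex_partition n x B A C"
  "vertex_partition n x A B C \<Longrightarrow> vertex_partition n x A C B"
  unfolding vertex_partition_def by auto

lemma vertex_partition_cases: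
  assumes "vertex_partition n x A B C" "y \<in> {1..n}"
  obtains "y = x" | "y \<in> A" | "y \<in> B" | "y \<in> C"
  using assms unfolding vertex_partition_def by blast

lemma three_graph_base_construction:
  assumes "vertex_partition n x A B C"
  shows "three_graph (base_construction n x A B C)"
proof -
  have "{x, u, v} \<in> [{1..n}]\<^bsup>3\<^esup>" if "{u, v} \<in> cross_pairs A B C" for u v
  proof -
    have "x \<noteq> u" "x \<noteq> v" "u \<noteq> v" "{x, u, v} \<subseteq> {1..n}"
      using that assms unfolding cross_pairs_iff vertex_partition_def by blast+
    then show ?thesis by (auto simp: nsets_def)
  qed
  then show ?thesis
    unfolding three_graph_def base_construction_def by auto
qed

lemma base_construction_link_iff:
  assumes "vertex_partition n x A B C"
  shows "{x, u, v} \<in> edges (base_construction n x A B C) \<longleftrightarrow> {u, v} \<in> cross_pairs A B C"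
proof
  assume "{x, u, v} \<in> edges (base_construction n x A B C)"
  then obtain u' v' where *: "{x, u, v} = {x, u', v'}" "{u', v'} \<in> cross_pairs A B C"
    by (auto simp: base_construction_def)
  have "x \<noteq> u'" "x \<noteq> v'" "u' \<noteq> v'"
    using *(2) assms unfolding cross_pairs_iff vertex_partition_def by blast+
  then have "{u, v} = {u', v'}"
  proof -
    have "card {x, u, v} = 3"
      using *(1) \<open>x \<noteq> u'\<close> \<open>x \<noteq> v'\<close> \<open>u' \<noteq> v'\<close> by simp
    then have "x \<noteq> u" "x \<noteq> v"
      by (auto simp: card_insert_if split: if_splits)
    then have "{u, v} = {x, u, v} - {x}" by auto
    also have "\<dots> = {u', v'}"
      using *(1) \<open>x \<noteq> u'\<close> \<open>x \<noteq> v'\<close> by auto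
    finally show ?thesis .
  qed
  then show "{u, v} \<in> cross_pairs A B C"
    using *(2) by simp
qed (auto simp: base_construction_def)

lemma base_construction_not_K4_at:
  assumes P: "vertex_partition n x A B C"
  shows "\<not> K4_at (base_construction n x A B C) x"
proof
  assume "K4_at (base_construction n x A B C) x"
  then obtain u v w where cr: "{u, v} \<in> cross_pairs A B C" "{u, w} \<in> cross_pairs A B C"
      "{v, w} \<in> cross_pairs A B C" and e: "{u, v, w} \<in> edges (base_construction n x A B C)"
    unfolding K4_at_def base_construction_link_iff[OF P] by blast
  have "x \<notin> {u, v, w}" "{u, v, w} \<inter> A \<noteq> {}" "{u, v, w} \<inter> B \<noteq> {}" "{u, v, w} \<inter> C \<noteq> {}"
    using cr P unfolding cross_pairs_iff vertex_partition_def by blast+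
  then show False
    using e unfolding base_construction_def by auto
qed

text \<open>
  A vertex of \<open>A\<close> forms edges with \<open>x\<close> and every vertex of the other two parts; two vertices of the same
  part form an edge with every third vertex except \<open>x\<close>; and \<open>y \<in> A\<close> and \<open>z \<in> B\<close> form
  an edge with \<open>x\<close> and with the remaining \<open>card A + card B - 2\<close> vertices of \<open>A \<union> B\<close>. The last
  case is the tight one.
\<close>

lemma base_construction_codegree:
  assumes P: "vertex_partition n x A B C"
    and ne: "A \<noteq> {}" "B \<noteq> {}" "C \<noteq> {}"
    and card: "d < card A + card B" "d < card A + card C" "d < card B + card C"
    and yz: "y \<in> {1..n}" "z \<in> {1..n}" "y \<noteq> z"
  shows "d \<le> codegree (base_construction n x A B C) y z"
proof -
  \<comment> \<open>All hypotheses are symmetric in the parts, so each type of pair needs to be treated only once.\<close>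
  define good where "good A B C \<longleftrightarrow> vertex_partition n x A B C \<and>
    A \<noteq> {} \<and> B \<noteq> {} \<and> C \<noteq> {} \<and> d < card A + card B \<and> d < card A + card C \<and> d < card B + card C" for A B C
  let ?G = "base_construction n x"
  have good: "good A B C" using assms unfolding good_def by blast
  have swap: "good B A C" "good A C B" if "good A B C" for A B C
    using that vertex_partition_permute[of n x A B C] unfolding good_def by (simp_all add: add.commute)
  have fin: "finite A" "finite B" "finite C" if "good A B C" for A B C
  proof -
    have "finite (A \<union> B \<union> C)"
      using that unfolding good_def vertex_partition_def by simp
    then show "finite A" "finite B" "finite C" by simp_all
  qed
  have mono: "d \<le> codegree (?G A B C) y z"
    if "good A B C" "y \<noteq> z" "d \<le> card W" "W \<subseteq> {1..n}"
      "\<And>w. w \<in> W \<Longrightarrow> {y, z, w} \<in> edges (?G A B C)" for A B C W y z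
  proof -
    have "card W \<le> card {w \<in> verts (?G A B C). {y, z, w} \<in> edges (?G A B C)}"
      using that by (intro card_mono) (auto simp: base_construction_def)
    then show ?thesis
      using that codegree_eq_card[OF three_graph_base_construction] by (fastforce simp: good_def)
  qed
  have apex: "d \<le> codegree (?G A B C) x z" if g: "good A B C" and z: "z \<in> A" for A B C z
  proof (rule mono[OF g, of x z "B \<union> C"])
    have P: "vertex_partition n x A B C" using g by (simp add: good_def)
    show "x \<noteq> z" "B \<union> C \<subseteq> {1..n}" using P z unfolding vertex_partition_def by auto
    have "card (B \<union> C) = card B + card C"
      using fin[OF g] P by (intro card_Un_disjoint) (auto simp: vertex_partition_def)
    then show "d \<le> card (B \<union> C)" using g by (simp add: good_def)
    show "{x, z, w} \<in> edges (?G A B C)" if "w \<in> B \<union> C" for w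
      unfolding base_construction_link_iff[OF P] cross_pairs_iff using z that by blast
  qed
  have same: "d \<le> codegree (?G A B C) y z"
    if g: "good A B C" and yz: "y \<in> A" "z \<in> A" "y \<noteq> z" for A B C y z
  proof (rule mono[OF g yz(3), of "(A \<union> B \<union> C) - {y, z}"])
    have P: "vertex_partition n x A B C" using g by (simp add: good_def)
    show "(A \<union> B \<union> C) - {y, z} \<subseteq> {1..n}" using P unfolding vertex_partition_def by auto
    have "card (A \<union> B \<union> C) = card A + card B + card C"
      using fin[OF g] P
      by (subst card_Un_disjoint; (subst card_Un_disjoint)?) (auto simp: vertex_partition_def)
    moreover have "card C > 0"
      using g fin[OF g] by (simp add: good_def card_gt_0_iff)
    ultimately show "d \<le> card ((A \<union> B \<union> C) - {y, z})"
      using g yz by (subst card_Diff_subset) (auto simp: good_def)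
    show "{y, z, w} \<in> edges (?G A B C)" if "w \<in> A \<union> B \<union> C - {y, z}" for w
    proof -
      have "{y, z, w} \<inter> B = {} \<or> {y, z, w} \<inter> C = {}" "x \<notin> {y, z, w}" "{y, z, w} \<subseteq> {1..n}"
        using P yz that unfolding vertex_partition_def by blast+
      moreover have "card {y, z, w} = 3" using yz that by auto
      ultimately show ?thesis by (auto simp: base_construction_def nsets_def)
    qed
  qed
  have different: "d \<le> codegree (?G A B C) y z"
    if g: "good A B C" and yz: "y \<in> A" "z \<in> B" for A B C y z
  proof -
    have P: "vertex_partition n x A B C" using g by (simp add: good_def)
    have ne: "y \<noteq> z" using P yz unfolding vertex_partition_def by auto
    show ?thesis
    proof (rule mono[OF g ne, of "insert x (A \<union> B - {y, z})"])
      show "insert x (A \<union> B - {y, z}) \<subseteq> {1..n}" using P unfolding vertex_partition_def by auto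
      have "card (A \<union> B) = card A + card B"
        using fin[OF g] P by (intro card_Un_disjoint) (auto simp: vertex_partition_def)
      then have "card (A \<union> B - {y, z}) = card A + card B - 2"
        using ne yz by (subst card_Diff_subset) auto
      moreover have "x \<notin> A \<union> B - {y, z}" "finite (A \<union> B - {y, z})"
        using P fin[OF g] by (auto simp: vertex_partition_def)
      ultimately show "d \<le> card (insert x (A \<union> B - {y, z}))"
        using g unfolding good_def by (simp, linarith)
      show "{y, z, w} \<in> edges (?G A B C)" if "w \<in> insert x (A \<union> B - {y, z})" for w
      proof (cases "w = x")
        case True
        then have "{y, z, w} = {x, y, z}" by auto
        then show ?thesis
          using base_construction_link_iff[OF P, of y z] yz by (auto simp: cross_pairs_iff)
      next
        case False
        then have "{y, z, w} \<inter> C = {}" "x \<notin> {y, z, w}" "{y, z, w} \<subseteq> {1..n}"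
          using P yz that unfolding vertex_partition_def by blast+
        moreover have "card {y, z, w} = 3" using ne that False by auto
        ultimately show ?thesis by (auto simp: base_construction_def nsets_def)
      qed
    qed
  qed
  have part: "d \<le> codegree (?G A B C) y z"
    if g: "good A B C" and y: "y \<in> A" and z: "z \<in> {1..n}" "y \<noteq> z" for A B C y z
  proof -
    consider "z = x" | "z \<in> A" | "z \<in> B" | "z \<in> C"
      using g z(1) unfolding good_def vertex_partition_def by blast
    then show ?thesis
    proof cases
      case 1
      then show ?thesis
        using apex[OF g y] by (simp add: codegree_def conj_commute)
    next
      case 2
      then show ?thesis using same[OF g y] z(2) by blast
    next
      case 3
      then show ?thesis using different[OF g y] by blast
    next
      case 4
      then show ?thesis
        using different[OF swap(2)[OF g] y] by (simp add: base_construction_swap23[of n x A C B])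
    qed
  qed
  note perms = base_construction_swap12[of n x B A C] base_construction_swap23[of n x A C B]
    base_construction_swap12[of n x C A B]
  consider "y = x" "z \<in> A" | "y = x" "z \<in> B" | "y = x" "z \<in> C" | "y \<in> A" | "y \<in> B" | "y \<in> C"
    using vertex_partition_cases[OF P yz(1)] vertex_partition_cases[OF P yz(2)] yz(3) by metis
  then show ?thesis
  proof cases
    case 1
    then show ?thesis using apex[OF good] by simp
  next
    case 2
    then show ?thesis using apex[OF swap(1)[OF good]] by (simp add: perms)
  next
    case 3
    then show ?thesis using apex[OF swap(1)[OF swap(2)[OF good]]] by (simp add: perms)
  next
    case 4
    then show ?thesis using part[OF good _ yz(2,3)] by simp
  next
    case 5
    then show ?thesis using part[OF swap(1)[OF good] _ yz(2,3)] by (simp add: perms)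
  next
    case 6
    then show ?thesis using part[OF swap(1)[OF swap(2)[OF good]] _ yz(2,3)] by (simp add: perms)
  qed
qed

lemma c2_K4_ge:
  assumes "0 < p" "0 < q" "0 < r" and n: "n = p + q + r + 1"
    and "d < p + q" "d < p + r" "d < q + r"
  shows "d \<le> c2_K4 n"
proof -
  let ?A = "{1..p}" and ?B = "{p + 1..p + q}" and ?C = "{p + q + 1..p + q + r}"
  let ?G = "base_construction n n ?A ?B ?C"
  have P: "vertex_partition n n ?A ?B ?C"
    using n unfolding vertex_partition_def by auto
  have G: "three_graph ?G" and V: "verts ?G = {1..n}"
    using three_graph_base_construction[OF P] by (simp_all add: base_construction_def)
  have "\<not> K4_covering ?G"
    using base_construction_not_K4_at[OF P] K4_covering_iff[OF G] V n by auto
  then have "min_codegree ?G \<le> c2_K4 n"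
    using c2_K4_lower[OF G] V n assms(1) by simp
  moreover obtain y z where "y \<in> {1..n}" "z \<in> {1..n}" "y \<noteq> z" "min_codegree ?G = codegree ?G y z"
    using min_codegree_attained[OF G] V n assms(1) by auto
  moreover from this have "d \<le> codegree ?G y z"
    using assms by (intro base_construction_codegree[OF P]) auto
  ultimately show ?thesis by simp
qed

section \<open>Embedding into a modification of the base construction\<close>

text \<open>
  For an edge \<open>uv\<close> of the link, the common neighbours \<open>w\<close> in the link and the vertices \<open>w\<close> with
  \<open>uvw\<close> an edge of \<open>G\<close> are disjoint subsets of the \<open>n - 2\<close> vertices other than \<open>u\<close> and \<open>v\<close>,
  because a vertex in both would complete a \<open>K\<^sub>4\<close> at \<open>x\<close>.
\<close>

lemma link_few_triangles_graph:
  assumes G: "three_graph G" and x: "x \<in> verts G" "\<not> K4_at G x"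
    and cod: "\<And>y z. y \<in> verts G \<Longrightarrow> z \<in> verts G \<Longrightarrow> y \<noteq> z \<Longrightarrow> d \<le> codegree G y z"
    and n: "card (verts G) = n" "2 * (n - 1) \<le> 3 * d + 5" "101 \<le> n"
  shows "few_triangles_graph (verts G - {x}) (\<lambda>u v. {x, u, v} \<in> edges G) d"
proof
  have fin: "finite (verts G)" using G by (simp add: three_graph_def)
  have card: "card (verts G - {x}) = n - 1" using n(1) x(1) by simp
  show "finite (verts G - {x})" "100 \<le> card (verts G - {x})" "2 * card (verts G - {x}) \<le> 3 * d + 5"
    using fin card n by simp_all
  show "{x, v, u} \<in> edges G" if "{x, u, v} \<in> edges G" for u v
    using that by (simp add: insert_commute)
  show "{x, v, v} \<notin> edges G" for v
    using three_graph_edgeD(6)[OF G, of x v v] by blast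
  show "d \<le> card {w \<in> verts G - {x}. {x, v, w} \<in> edges G}" if v: "v \<in> verts G - {x}" for v
  proof -
    have "{w \<in> verts G - {x}. {x, v, w} \<in> edges G} = {w \<in> verts G. {x, v, w} \<in> edges G}"
      using three_graph_edgeD(5)[OF G, of x v] by blast
    then show ?thesis
      using cod[of x v] codegree_eq_card[OF G, of x v] v x(1) by auto
  qed
  show "card {w \<in> verts G - {x}. {x, u, w} \<in> edges G \<and> {x, v, w} \<in> edges G} + d + 1 \<le> card (verts G - {x})"
    if uv: "u \<in> verts G - {x}" "v \<in> verts G - {x}" "{x, u, v} \<in> edges G" for u v
  proof -
    let ?T = "{w \<in> verts G - {x}. {x, u, w} \<in> edges G \<and> {x, v, w} \<in> edges G}"
    let ?D = "{w \<in> verts G. {u, v, w} \<in> edges G}"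
    have ne: "u \<noteq> v" using three_graph_edgeD(6)[OF G uv(3)] .
    have "card ?T + card ?D = card (?T \<union> ?D)"
      using fin x(2) uv(3) unfolding K4_at_def by (intro card_Un_disjoint[symmetric]) auto
    also have "\<dots> \<le> card (verts G - {u, v})"
    proof (intro card_mono)
      show "?T \<union> ?D \<subseteq> verts G - {u, v}"
        by (auto dest: three_graph_edgeD[OF G])
    qed (use fin in simp)
    also have "\<dots> = n - 2"
      using ne uv n(1) by (subst card_Diff_subset) auto
    finally show ?thesis
      using cod[of u v] codegree_eq_card[OF G ne] uv ne card n(3) by auto
  qed
qed

text \<open>
  The only edges of \<open>G\<close> not obviously present in the modification are the tripartite ones \<open>abc\<close>.
  As \<open>x\<close> is uncovered, one of \<open>ab, ac, bc\<close> is missing from the link of \<open>x\<close>, and that pair was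
  collected, so \<open>abc\<close> was added.
\<close>

lemma subgraph_modification:
  assumes G: "three_graph G" "verts G = {1..n}" and P: "vertex_partition n x V1 V2 V3"
    and x: "\<not> K4_at G x"
    and indep: "\<And>A u v. A \<in> {V1, V2, V3} \<Longrightarrow> u \<in> A \<Longrightarrow> v \<in> A \<Longrightarrow> {x, u, v} \<notin> edges G"
  shows "subgraph G (modification n x V1 V2 V3 {p \<in> cross_pairs V1 V2 V3. insert x p \<notin> edges G})"
proof -
  define E where "E = {p \<in> cross_pairs V1 V2 V3. insert x p \<notin> edges G}"
  let ?F = "modification n x V1 V2 V3 E"
  have "e \<in> edges ?F" if e: "e \<in> edges G" for e
  proof -
    have e3: "e \<in> [{1..n}]\<^bsup>3\<^esup>" "e \<subseteq> {1..n}" "card e = 3" "finite e"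
      using G e unfolding three_graph_def nsets_def by auto
    show ?thesis
    proof (cases "x \<in> e")
      case True
      then have "card (e - {x}) = 2" using e3 by simp
      then obtain u v where uv: "e - {x} = {u, v}" "u \<noteq> v"
        by (auto simp: card_2_iff)
      then have e_eq: "e = {x, u, v}" using True by auto
      have "u \<in> V1 \<union> V2 \<union> V3" "v \<in> V1 \<union> V2 \<union> V3"
        using uv e3(2) P unfolding vertex_partition_def by auto
      then have "{u, v} \<in> cross_pairs V1 V2 V3"
        using indep e unfolding e_eq cross_pairs_iff by blast
      moreover have "e \<notin> {{x, u, v} | u v. {u, v} \<in> E}"
        using e unfolding E_def by auto
      ultimately show ?thesis
        unfolding modification_def base_construction_def e_eq by auto
    next
      case False
      show ?thesis
      proof (cases "e \<inter> V1 = {} \<or> e \<inter> V2 = {} \<or> e \<inter> V3 = {}")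
        case True
        then show ?thesis
          using False e3(1) unfolding modification_def base_construction_def by auto
      next
        case nonempty: False
        then obtain a b c where abc: "a \<in> e" "a \<in> V1" "b \<in> e" "b \<in> V2" "c \<in> e" "c \<in> V3"
          by blast
        have "a \<noteq> b" "a \<noteq> c" "b \<noteq> c"
          using abc P unfolding vertex_partition_def by auto
        then have e_eq: "e = {a, b, c}"
          using abc e3 by (intro card_subset_eq[symmetric]) auto
        have tri: "{a, b, c} \<in> tripartite V1 V2 V3"
          using abc unfolding tripartite_def by blast
        have "\<not> ({x, a, b} \<in> edges G \<and> {x, a, c} \<in> edges G \<and> {x, b, c} \<in> edges G)"
          using x e unfolding K4_at_def e_eq by blast
        then have "{a, b} \<in> E \<or> {a, c} \<in> E \<or> {b, c} \<in> E"
          using abc unfolding E_def by (auto simp: cross_pairs_iff)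
        moreover have "{a, b, c} = {a, c, b}" "{a, b, c} = {b, c, a}"
          by auto
        ultimately have "e \<in> {{u, v, w} | u v w. {u, v} \<in> E \<and> {u, v, w} \<in> tripartite V1 V2 V3}"
          unfolding e_eq mem_Collect_eq using tri by metis
        then show ?thesis unfolding modification_def by simp
      qed
    qed
  qed
  then show ?thesis
    using G unfolding subgraph_def E_def[symmetric] by (auto simp: modification_def)
qed

text \<open>
  A vertex of a part \<open>A\<close> has at least \<open>d\<close> neighbours among the \<open>n - 1 - |A|\<close> vertices of the other
  parts, which bounds the number of missing pairs at it by \<open>n - 1 - d - |A|\<close>. This single
  bound yields all the admissibility conditions.
\<close>

lemma uncovered_vertex_structure:
  assumes G: "three_graph G" "verts G = {1..n}" and x: "x \<in> {1..n}" "\<not> K4_at G x"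
    and cod: "\<And>y z. y \<in> {1..n} \<Longrightarrow> z \<in> {1..n} \<Longrightarrow> y \<noteq> z \<Longrightarrow> d \<le> codegree G y z"
    and n: "2 * (n - 1) \<le> 3 * d + 5" "101 \<le> n"
  obtains V1 V2 V3 E where "vertex_partition n x V1 V2 V3"
    "card V1 \<le> card V2" "card V2 \<le> card V3"
    "\<forall>A\<in>{V1, V2, V3}. card A + d + 2 \<le> n"
    "E \<subseteq> cross_pairs V1 V2 V3"
    "\<forall>A\<in>{V1, V2, V3}. pairs_at_most E (n - 1 - d - card A) A"
    "subgraph G (modification n x V1 V2 V3 E)"
proof -
  interpret few_triangles_graph "{1..n} - {x}" "\<lambda>u v. {x, u, v} \<in> edges G" d
    unfolding G(2)[symmetric]
    by (rule link_few_triangles_graph[OF G(1) _ x(2) _ _ n]) (use G(2) x cod in simp_all)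
  obtain V1 V2 V3 where V: "{1..n} - {x} = V1 \<union> V2 \<union> V3"
      "V1 \<inter> V2 = {}" "V1 \<inter> V3 = {}" "V2 \<inter> V3 = {}"
    and indep: "\<And>A u v. A \<in> {V1, V2, V3} \<Longrightarrow> u \<in> A \<Longrightarrow> v \<in> A \<Longrightarrow> {x, u, v} \<notin> edges G"
    and small: "\<And>A. A \<in> {V1, V2, V3} \<Longrightarrow> card A + d + 1 \<le> card ({1..n} - {x})"
    and ord: "card V1 \<le> card V2" "card V2 \<le> card V3"
  proof (rule ordered_tripartition_exists)
    fix V1 V2 V3
    assume *: "{1..n} - {x} = V1 \<union> V2 \<union> V3" "V1 \<inter> V2 = {}" "V1 \<inter> V3 = {}" "V2 \<inter> V3 = {}"
      "\<And>A u v. A \<in> {V1, V2, V3} \<Longrightarrow> u \<in> A \<Longrightarrow> v \<in> A \<Longrightarrow> {x, u, v} \<notin> edges G"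
      "\<And>A. A \<in> {V1, V2, V3} \<Longrightarrow> card A + d + 1 \<le> card ({1..n} - {x})"
      "card V1 \<le> card V2" "card V2 \<le> card V3"
    show thesis by (rule that[OF *])
  qed
  have P: "vertex_partition n x V1 V2 V3"
    using V x unfolding vertex_partition_def by simp
  have card: "card ({1..n} - {x}) = n - 1" using x by simp
  define E where "E = {p \<in> cross_pairs V1 V2 V3. insert x p \<notin> edges G}"
  have few: "pairs_at_most E (n - 1 - d - card A) A" if A: "A \<in> {V1, V2, V3}" for A
    unfolding pairs_at_most_def
  proof
    fix v assume v: "v \<in> A"
    let ?W = "{w \<in> {1..n} - {x} - A. {x, v, w} \<notin> edges G}"
    have AV: "A \<subseteq> {1..n} - {x}" using A V(1) by auto
    have "{p \<in> E. v \<in> p} \<subseteq> (\<lambda>w. {v, w}) ` ?W"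
    proof
      fix p assume p: "p \<in> {p \<in> E. v \<in> p}"
      then obtain a b where "p = {a, b}" by (auto simp: E_def cross_pairs_def)
      then obtain w where w: "p = {v, w}" using p by auto
      then have cr: "{v, w} \<in> cross_pairs V1 V2 V3" and "{x, v, w} \<notin> edges G"
        using p by (auto simp: E_def)
      moreover have "w \<in> {1..n} - {x} - A"
        using cr A v V(2-4) unfolding cross_pairs_iff V(1) by blast
      ultimately show "p \<in> (\<lambda>w. {v, w}) ` ?W" using w by blast
    qed
    then have "card {p \<in> E. v \<in> p} \<le> card ?W"
      by (rule surj_card_le[rotated]) simp
    then show "card {p \<in> E. v \<in> p} \<le> n - 1 - d - card A"
      using independent_degree_le[OF AV v indep[OF A v]] card by simp
  qed
  show thesis
  proof (rule that[OF P ord])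
    show "\<forall>A\<in>{V1, V2, V3}. card A + d + 2 \<le> n"
    proof
      fix A assume "A \<in> {V1, V2, V3}"
      from small[OF this] show "card A + d + 2 \<le> n" using card by simp
    qed
    show "\<forall>A\<in>{V1, V2, V3}. pairs_at_most E (n - 1 - d - card A) A"
      using few by blast
    show "E \<subseteq> cross_pairs V1 V2 V3" by (auto simp: E_def)
    show "subgraph G (modification n x V1 V2 V3 E)"
      unfolding E_def by (rule subgraph_modification[OF G P x(2) indep])
  qed
qed

section \<open>Relabelling the vertices\<close>

definition relabel :: "('a \<Rightarrow> 'b) \<Rightarrow> 'a hypergraph3 \<Rightarrow> 'b hypergraph3" where
  "relabel f G = Hypergraph3 (f ` verts G) ((\<lambda>e. f ` e) ` edges G)"

lemma isomorphic_relabel: "inj_on f (verts G) \<Longrightarrow> isomorphic G (relabel f G)"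
  unfolding isomorphic_def relabel_def by (intro exI[of _ f]) (simp add: bij_betw_def)

lemma three_graph_relabel:
  assumes G: "three_graph G" and f: "inj_on f (verts G)"
  shows "three_graph (relabel f G)"
proof -
  have "f ` e \<in> [f ` verts G]\<^bsup>3\<^esup>" if "e \<in> edges G" for e
  proof -
    have "e \<subseteq> verts G" "finite e" "card e = 3"
      using G that unfolding three_graph_def nsets_def by auto
    then show ?thesis
      using card_image[of f e] inj_on_subset[OF f] by (auto simp: nsets_def)
  qed
  then show ?thesis
    using G unfolding three_graph_def relabel_def by auto
qed

lemma relabel_edge_iff:
  assumes G: "three_graph G" and f: "inj_on f (verts G)" and e: "e \<subseteq> verts G"
  shows "f ` e \<in> edges (relabel f G) \<longleftrightarrow> e \<in> edges G"
proof -
  have "e \<in> edges G" if fe: "f ` e \<in> edges (relabel f G)"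
  proof -
    obtain e' where e': "e' \<in> edges G" "f ` e = f ` e'"
      using fe unfolding relabel_def hypergraph3.sel by blast
    have "e' \<subseteq> verts G"
      using G e'(1) unfolding three_graph_def nsets_def by blast
    then have "e = e'"
      using inj_on_image_eq_iff[OF f e] e'(2) by blast
    then show ?thesis
      using e'(1) by simp
  qed
  moreover have "f ` e \<in> edges (relabel f G)" if "e \<in> edges G"
    using that by (simp add: relabel_def)
  ultimately show ?thesis by blast
qed

lemma K4_at_relabelD:
  assumes G: "three_graph G" and f: "inj_on f (verts G)" and x: "x \<in> verts G"
    and K: "K4_at (relabel f G) (f x)"
  shows "K4_at G x"
proof -
  obtain u' v' w' where e: "{f x, u', v'} \<in> edges (relabel f G)" "{f x, u', w'} \<in> edges (relabel f G)"
      "{f x, v', w'} \<in> edges (relabel f G)" "{u', v', w'} \<in> edges (relabel f G)"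
    using K unfolding K4_at_def by blast
  have "u' \<in> f ` verts G" "v' \<in> f ` verts G" "w' \<in> f ` verts G"
    using three_graph_edgeD(1-3)[OF three_graph_relabel[OF G f] e(4)] by (simp_all add: relabel_def)
  then obtain u v w where uvw: "u \<in> verts G" "v \<in> verts G" "w \<in> verts G"
    and eq: "u' = f u" "v' = f v" "w' = f w"
    by blast
  have iff: "{f a, f b, f c} \<in> edges (relabel f G) \<longleftrightarrow> {a, b, c} \<in> edges G"
    if "a \<in> verts G" "b \<in> verts G" "c \<in> verts G" for a b c
    using relabel_edge_iff[OF G f, of "{a, b, c}"] that by simp
  show ?thesis
    unfolding K4_at_def using e x uvw unfolding eq iff[OF x uvw(1,2)] iff[OF x uvw(1,3)]
      iff[OF x uvw(2,3)] iff[OF uvw] by blast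
qed

lemma codegree_relabel:
  assumes G: "three_graph G" and f: "inj_on f (verts G)" and yz: "y \<in> verts G" "z \<in> verts G"
  shows "codegree (relabel f G) (f y) (f z) = codegree G y z"
proof -
  have sub: "e \<subseteq> verts G" if "e \<in> edges G" for e
    using that G unfolding three_graph_def nsets_def by blast
  have "{e \<in> edges (relabel f G). f y \<in> e \<and> f z \<in> e} = (\<lambda>e. f ` e) ` {e \<in> edges G. y \<in> e \<and> z \<in> e}"
  proof -
    have "{e \<in> edges (relabel f G). f y \<in> e \<and> f z \<in> e}
        = (\<lambda>e. f ` e) ` {e \<in> edges G. f y \<in> f ` e \<and> f z \<in> f ` e}"
      unfolding relabel_def hypergraph3.sel by blast
    also have "{e \<in> edges G. f y \<in> f ` e \<and> f z \<in> f ` e} = {e \<in> edges G. y \<in> e \<and> z \<in> e}"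
      using inj_on_image_mem_iff[OF f yz(1) sub] inj_on_image_mem_iff[OF f yz(2) sub] by blast
    finally show ?thesis .
  qed
  moreover have "inj_on (\<lambda>e. f ` e) {e \<in> edges G. y \<in> e \<and> z \<in> e}"
    using sub by (intro inj_on_subset[OF inj_on_image_Pow[OF f]]) blast
  ultimately show ?thesis
    unfolding codegree_def by (simp add: card_image)
qed

text \<open>
  Extremality is used through a lower bound \<open>d \<le> c\<^sub>2(n, K\<^sub>4)\<close>, which bounds every codegree of \<open>G\<close> from
  below by \<open>d\<close>. Moving \<open>G\<close> to the vertex set \<open>{1..n}\<close> makes the parts sets of numbers.
\<close>

lemma extremal_structure:
  fixes G :: "'a hypergraph3"
  assumes ext: "extremal_K4 n G" and d: "d \<le> c2_K4 n"
    and n: "2 * (n - 1) \<le> 3 * d + 5" "101 \<le> n"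
  shows "\<exists>x V1 V2 V3 E. vertex_partition n x V1 V2 V3 \<and>
    card V1 \<le> card V2 \<and> card V2 \<le> card V3 \<and> card V1 + card V2 + card V3 + 1 = n \<and>
    card V3 + d + 2 \<le> n \<and> E \<subseteq> cross_pairs V1 V2 V3 \<and>
    pairs_at_most E (n - 1 - d - card V1) V1 \<and> pairs_at_most E (n - 1 - d - card V2) V2 \<and>
    pairs_at_most E (n - 1 - d - card V3) V3 \<and>
    isomorphic_to_subgraph G (modification n x V1 V2 V3 E)"
proof -
  have G: "three_graph G" "card (verts G) = n" "d \<le> min_codegree G"
    using ext d unfolding extremal_K4_def by auto
  obtain x where x: "x \<in> verts G" "\<not> K4_at G x"
    using ext K4_covering_iff[OF G(1)] unfolding extremal_K4_def by blast
  obtain f where f: "bij_betw f (verts G) {1..n}"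
    using finite_same_card_bij[of "verts G" "{1..n}"] G(1,2) unfolding three_graph_def by auto
  have inj: "inj_on f (verts G)" and im: "f ` verts G = {1..n}"
    using bij_betw_imp_inj_on[OF f] bij_betw_imp_surj_on[OF f] by simp_all
  have cod: "d \<le> codegree (relabel f G) y z" if yz: "y \<in> {1..n}" "z \<in> {1..n}" "y \<noteq> z" for y z
  proof -
    obtain y' z' where *: "y' \<in> verts G" "y = f y'" "z' \<in> verts G" "z = f z'"
      using yz unfolding im[symmetric] by blast
    then have "y' \<noteq> z'"
      using yz(3) by blast
    then show ?thesis
      using codegree_relabel[OF G(1) inj *(1,3)] min_codegree_le[OF G(1) *(1,3)] G(3) *(2,4)
      by simp
  qed
  have fx: "f x \<in> {1..n}" "\<not> K4_at (relabel f G) (f x)"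
    using K4_at_relabelD[OF G(1) inj x(1)] x im by blast+
  have verts: "verts (relabel f G) = {1..n}"
    using im by (simp add: relabel_def)
  obtain V1 V2 V3 E where V: "vertex_partition n (f x) V1 V2 V3"
    "card V1 \<le> card V2" "card V2 \<le> card V3"
    "\<forall>A\<in>{V1, V2, V3}. card A + d + 2 \<le> n"
    "E \<subseteq> cross_pairs V1 V2 V3"
    "\<forall>A\<in>{V1, V2, V3}. pairs_at_most E (n - 1 - d - card A) A"
    "subgraph (relabel f G) (modification n (f x) V1 V2 V3 E)"
    using uncovered_vertex_structure[OF three_graph_relabel[OF G(1) inj] verts fx cod n] by blast
  have "card V1 + card V2 + card V3 + 1 = n"
  proof -
    have "finite (V1 \<union> V2 \<union> V3)"
      using V(1) unfolding vertex_partition_def by simp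
    then have fin: "finite V1" "finite V2" "finite V3"
      by simp_all
    have "card (V1 \<union> V2 \<union> V3) = card V1 + card V2 + card V3"
      using fin V(1) unfolding vertex_partition_def
      by (subst card_Un_disjoint; (subst card_Un_disjoint)?) auto
    moreover have "card ({1..n} - {f x}) = n - 1" "1 \<le> n"
      using V(1) unfolding vertex_partition_def by auto
    ultimately show ?thesis
      using V(1) unfolding vertex_partition_def by simp
  qed
  moreover have "isomorphic_to_subgraph G (modification n (f x) V1 V2 V3 E)"
    using V(7) isomorphic_relabel[OF inj] unfolding isomorphic_to_subgraph_def by blast
  ultimately show ?thesis
    using V by (intro exI[of _ "f x"] exI[of _ V1] exI[of _ V2] exI[of _ V3] exI[of _ E]) simp
qed

theorem theorem2p10:
  shows "(\<forall>n (G :: 'a hypergraph3). n mod 3 = 0 \<and> n \<ge> 858 \<and> extremal_K4 n G \<longrightarrow>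
            (\<exists>F. is_F1 n F \<and> isomorphic_to_subgraph G F))
       \<and> (\<forall>n (G :: 'a hypergraph3). n mod 3 = 1 \<and> n \<ge> 715 \<and> extremal_K4 n G \<longrightarrow>
            (\<exists>F. is_F1 n F \<and> isomorphic_to_subgraph G F))
       \<and> (\<forall>n (G :: 'a hypergraph3). n mod 3 = 2 \<and> n \<ge> 1001 \<and> extremal_K4 n G \<longrightarrow>
            (\<exists>F. (is_F1 n F \<or> is_F1' n F) \<and> isomorphic_to_subgraph G F))"
proof (intro conjI allI impI)
  fix n and G :: "'a hypergraph3"
  assume asm: "n mod 3 = 0 \<and> n \<ge> 858 \<and> extremal_K4 n G"
  define m where "m = n div 3"
  have "3 * m + n mod 3 = n" unfolding m_def by (rule mult_div_mod_eq)
  then have m: "n = 3 * m" "m \<ge> 2" "n \<ge> 101" using asm by linarith+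
  have n: "2 * (n - 1) \<le> 3 * (2 * m - 2) + 5" "101 \<le> n"
    using m by linarith+
  have lower: "2 * m - 2 \<le> c2_K4 n"
    using m(1,2) by (intro c2_K4_ge[of "m - 1" m m]) auto
  obtain x V1 V2 V3 E where V: "vertex_partition n x V1 V2 V3"
    "card V1 \<le> card V2" "card V2 \<le> card V3" "card V1 + card V2 + card V3 + 1 = n"
    "card V3 + (2 * m - 2) + 2 \<le> n" "E \<subseteq> cross_pairs V1 V2 V3"
    "pairs_at_most E (n - 1 - (2 * m - 2) - card V1) V1"
    "pairs_at_most E (n - 1 - (2 * m - 2) - card V2) V2"
    "pairs_at_most E (n - 1 - (2 * m - 2) - card V3) V3"
    "isomorphic_to_subgraph G (modification n x V1 V2 V3 E)"
    using extremal_structure[of n G "2 * m - 2", OF _ lower n] asm by blast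
  \<comment> \<open>The sizes are at most \<open>m\<close> and add up to \<open>3 m - 1\<close>.\<close>
  have sizes: "card V1 = m - 1" "card V2 = m" "card V3 = m"
    using V(2-5) m by linarith+
  have "n - 1 - (2 * m - 2) - card V1 = 2" "n - 1 - (2 * m - 2) - card V2 = 1"
    "n - 1 - (2 * m - 2) - card V3 = 1"
    using sizes m by linarith+
  then have "F1_admissible n V1 V2 V3 E"
    using V(6-9) asm unfolding F1_admissible_def pairs_at_most_def by auto
  moreover have "F1_parts n x V1 V2 V3"
    using V(1) sizes m unfolding F1_parts_def by blast
  ultimately show "\<exists>F. is_F1 n F \<and> isomorphic_to_subgraph G F"
    using V(10) unfolding is_F1_def by blast
next
  fix n and G :: "'a hypergraph3"
  assume asm: "n mod 3 = 1 \<and> n \<ge> 715 \<and> extremal_K4 n G"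
  define m where "m = n div 3"
  have "3 * m + n mod 3 = n" unfolding m_def by (rule mult_div_mod_eq)
  then have m: "n = 3 * m + 1" "m \<ge> 2" "n \<ge> 101" using asm by linarith+
  have n: "2 * (n - 1) \<le> 3 * (2 * m - 1) + 5" "101 \<le> n"
    using m by linarith+
  have lower: "2 * m - 1 \<le> c2_K4 n"
    using m(1,2) by (intro c2_K4_ge[of m m m]) auto
  obtain x V1 V2 V3 E where V: "vertex_partition n x V1 V2 V3"
    "card V1 \<le> card V2" "card V2 \<le> card V3" "card V1 + card V2 + card V3 + 1 = n"
    "card V3 + (2 * m - 1) + 2 \<le> n" "E \<subseteq> cross_pairs V1 V2 V3"
    "pairs_at_most E (n - 1 - (2 * m - 1) - card V1) V1"
    "pairs_at_most E (n - 1 - (2 * m - 1) - card V2) V2"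
    "pairs_at_most E (n - 1 - (2 * m - 1) - card V3) V3"
    "isomorphic_to_subgraph G (modification n x V1 V2 V3 E)"
    using extremal_structure[of n G "2 * m - 1", OF _ lower n] asm by blast
  \<comment> \<open>The sizes are at most \<open>m\<close> and add up to \<open>3 m\<close>.\<close>
  have sizes: "card V1 = m" "card V2 = m" "card V3 = m"
    using V(2-5) m by linarith+
  have "n - 1 - (2 * m - 1) - m = 1"
    using m by linarith
  then have "F1_admissible n V1 V2 V3 E"
    using V(6-9) asm unfolding F1_admissible_def pairs_at_most_def sizes by auto
  moreover have "F1_parts n x V1 V2 V3"
    using V(1) sizes m unfolding F1_parts_def by blast
  ultimately show "\<exists>F. is_F1 n F \<and> isomorphic_to_subgraph G F"
    using V(10) unfolding is_F1_def by blast
next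
  fix n and G :: "'a hypergraph3"
  assume asm: "n mod 3 = 2 \<and> n \<ge> 1001 \<and> extremal_K4 n G"
  define m where "m = n div 3"
  have "3 * m + n mod 3 = n" unfolding m_def by (rule mult_div_mod_eq)
  then have m: "n = 3 * m + 2" "m \<ge> 2" "n \<ge> 101" using asm by linarith+
  have n: "2 * (n - 1) \<le> 3 * (2 * m - 1) + 5" "101 \<le> n"
    using m by linarith+
  have lower: "2 * m - 1 \<le> c2_K4 n"
    using m(1,2) by (intro c2_K4_ge[of m m "m + 1"]) auto
  obtain x V1 V2 V3 E where V: "vertex_partition n x V1 V2 V3"
    "card V1 \<le> card V2" "card V2 \<le> card V3" "card V1 + card V2 + card V3 + 1 = n"
    "card V3 + (2 * m - 1) + 2 \<le> n" "E \<subseteq> cross_pairs V1 V2 V3"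
    "pairs_at_most E (n - 1 - (2 * m - 1) - card V1) V1"
    "pairs_at_most E (n - 1 - (2 * m - 1) - card V2) V2"
    "pairs_at_most E (n - 1 - (2 * m - 1) - card V3) V3"
    "isomorphic_to_subgraph G (modification n x V1 V2 V3 E)"
    using extremal_structure[of n G "2 * m - 1", OF _ lower n] asm by blast
  \<comment> \<open>The sizes are at most \<open>m + 1\<close> and add up to \<open>3 m + 1\<close>, which leaves two possibilities.\<close>
  have "card V3 = m + 1"
    using V(2-5) m by linarith
  moreover have "card V1 = m \<and> card V2 = m \<or> card V1 = m - 1 \<and> card V2 = m + 1"
    using V(2-5) m calculation by linarith
  ultimately consider "card V1 = m" "card V2 = m" "card V3 = m + 1"
    | "card V1 = m - 1" "card V2 = m + 1" "card V3 = m + 1"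
    by blast
  then show "\<exists>F. (is_F1 n F \<or> is_F1' n F) \<and> isomorphic_to_subgraph G F"
  proof cases
    case 1
    have "n - 1 - (2 * m - 1) - m = 2" "n - 1 - (2 * m - 1) - (m + 1) = 1"
      using m by linarith+
    then have "F1_admissible n V1 V2 V3 E"
      using V(6-9) asm unfolding F1_admissible_def pairs_at_most_def 1 by auto
    moreover have "F1_parts n x V1 V2 V3"
      using V(1) 1 m unfolding F1_parts_def by blast
    ultimately show ?thesis
      using V(10) unfolding is_F1_def by blast
  next
    case 2
    have "n - 1 - (2 * m - 1) - (m - 1) = 3" "n - 1 - (2 * m - 1) - (m + 1) = 1"
      using m by linarith+
    then have "F1'_admissible V1 V2 V3 E"
      using V(6-9) unfolding F1'_admissible_def pairs_at_most_def 2 by auto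
    moreover have "F1'_parts n x V1 V2 V3"
      using V(1) 2 m unfolding F1'_parts_def by blast
    ultimately show ?thesis
      using V(10) unfolding is_F1'_def by blast
  qed
qed

end
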